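(* With the swing option value functional $\mathcal V$ defined in the context, for any $i\in\{0,\dots,M\}$, $$\mathcal V(\tau_i,Q(\tau_i))=\operatorname*{ess\,sup}_{q\in U,\ q\le Q(\tau_i)}E_{\mathscr F^S_{\tau_i}}\Big\{q\,(K-S(\tau_i))^+ +e^{-\mu(\tau_{i+1}-\tau_i)}\,\mathcal V(\tau_{i+1},Q(\tau_{i+1}))\Big\},$$ where, inside the essential supremum, $Q(\tau_{i+1})=Q(\tau_i)-q$.
   Context: Price model. Let $(\Omega,\mathscr F,\{\mathscr F_t\}_{t\ge0},\mathbb P)$ be a complete filtered probability space with filtration generated by a one-dimensional Wiener process $W$ and the $\mathbb P$-null sets. Fix constants $\alpha\in(\tfrac12,\tfrac32)$, $\delta>0$, $\lambda,V_0,V_1,V_2\ge0$, $r,\gamma_1,\gamma_2\in\mathbb R$ and a deterministic time-periodic function $P$. The price is $S(t)=e^{\overline S(t)}$, $t\in[0,T]$, where $(\overline S,X)$ is the (continuous, adapted) solution, with given $\overline S(0),X(0)$ and with normalized storage $X+P$ in $(0,1]$, of $$d\overline S(t)=\Big(r-\tfrac12\sigma(t)^2-\lambda\overline S(t)\Big)dt+\sigma(t)dW(t),$$ $$\sigma(t)=V_0+\frac{V_1}{(X(t)+P(t))(1-X(t)-P(t))+\delta}+V_2\sqrt{|\overline S^{\alpha,\delta}_t-\overline S(0)|+\delta},$$ $$dX(t)=\big[\gamma_1R^+(t)(1-X(t)-P(t))-\gamma_2R^-(t)(X(t)+P(t))\big]dt,$$ with $\overline S^{\alpha,\delta}_t=(1-\alpha)\int_0^t\frac{\overline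 S(u)}{(t+\delta)^{1-\alpha}(t-u+\delta)^{\alpha}}du+\overline S(t)1_{\{\alpha=1\}}$, $R(t)=(1-\alpha)\int_0^t\frac{\overline S(u)-\overline S(t)}{(t+\delta)^{1-\alpha}(t-u+\delta)^{\alpha}}du$, and $R^\pm$ the (nonnegative) positive and negative parts of $R$. Let $\{\mathscr F^S_t\}_{t\in[0,T]}$ be the filtration generated by $S$, and write $E_{\mathscr F^S_t}[\cdot]=E[\cdot\,|\,\mathscr F^S_t]$. Contract. $K>0$ is the strike; $L,\tilde L\in\mathbb N$ are the global and local limits on exercised rights; $\mathbb I=\{\tau_0<\tau_1<\dots<\tau_M\}\subset[0,T)$ is the set of exercise times, $M\in\mathbb N^+$, and $\tau_{M+1}=T$; $\tilde L\le L\le(M+1)\tilde L$. Put $U=\{0,1,\dots,\tilde L\}$ and let $\mathcal U$ be the set of $U$-valued $\{\mathscr F^S_t\}$-adapted processes $q=(q(t))_{t\in\mathbb I}$. The number of remaining rights is $$Q(t)=L-\sum_{s\in\mathbb I,\,s<t}q(s)\,1_{\{Q(s)\ge q(s)\}}\ \ (\ge0),$$ so that $Q(\tau_{j+1})=Q(\tau_j)-q(\tau_j)1_{\{Q(\tau_j)\ge q(\tau_j)\}}$. In the value functional below, $Q(\tau_i)$ acts as a state variable: it is an $\mathscr F^S_{\tau_i}$-measurable random variable with values in $\{0,\dots,L\}$ (the number of rights remaining at $\tau_i$), and $Q(\tau_{i+1}),\dots,Q(\tau_{M+1})=Q(T)$ are obtained from it and from $q(\tau_i),\dots,q(\tau_M)$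 by this recursion. $\mu\ge0$ is the risk-free rate, and $G(S(T),Q(T))$ is a penalty at maturity, where $G$ is a measurable real-valued function such that $G(S(T),l)$ is integrable for each $l\in\{0,\dots,L\}$. Reward and value, for $i\in\{0,\dots,M\}$: $$\mathcal J(\tau_i,Q(\tau_i);q)=E_{\mathscr F^S_{\tau_i}}\Big[\sum_{j=i}^{M}e^{-\mu(\tau_j-\tau_i)}q(\tau_j)(K-S(\tau_j))^+1_{\{Q(\tau_j)\ge q(\tau_j)\}}+e^{-\mu(T-\tau_i)}G(S(T),Q(T))\Big],$$ $$\mathcal V(\tau_i,Q(\tau_i))=\operatorname*{ess\,sup}_{q\in\mathcal U}\mathcal J(\tau_i,Q(\tau_i);q),\qquad \mathcal V(\tau_{M+1},Q(\tau_{M+1}))=G(S(T),Q(T)).$$ *)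

theory Defs
  imports "HOL-Probability.Probability"
begin

section \<open>Essential suprema of families of random variables\<close>

text \<open>The library function \<open>esssup\<close> is the essential supremum of a single function; what is
  needed here is the least (up to null sets) random variable that dominates every member of a
  possibly uncountable family.\<close>

definition is_family_esssup :: "'a measure \<Rightarrow> ('a \<Rightarrow> real) set \<Rightarrow> ('a \<Rightarrow> real) \<Rightarrow> bool" where
  "is_family_esssup M A Y \<longleftrightarrow>
     Y \<in> borel_measurable M \<and>
     (\<forall>f\<in>A. AE x in M. f x \<le> Y x) \<and>
     (\<forall>Z\<in>borel_measurable M. (\<forall>f\<in>A. AE x in M. f x \<le> Z x) \<longrightarrow> (AE x in M. Y x \<le> Z x))"

text \<open>A version of the essential supremum. It is unique up to null sets and exists as soon as the
  family is nonempty and dominated by one random variable; both facts are proved below.\<close>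

definition family_esssup :: "'a measure \<Rightarrow> ('a \<Rightarrow> real) set \<Rightarrow> 'a \<Rightarrow> real" where
  "family_esssup M A = (SOME Y. is_family_esssup M A Y)"

lemma is_family_esssup_unique:
  assumes "is_family_esssup M A Y" "is_family_esssup M A Y'"
  shows "AE x in M. Y x = Y' x"
proof -
  have "AE x in M. Y x \<le> Y' x" "AE x in M. Y' x \<le> Y x"
    using assms unfolding is_family_esssup_def by blast+
  then show ?thesis by eventually_elim simp
qed

lemma (in prob_space) family_esssup_exists:
  fixes A :: "('a \<Rightarrow> real) set"
  assumes ne: "A \<noteq> {}" and meas: "A \<subseteq> borel_measurable M"
    and g: "g \<in> borel_measurable M" "\<And>f. f \<in> A \<Longrightarrow> AE x in M. f x \<le> g x"
  shows "is_family_esssup M A (family_esssup M A)"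
proof -
  define h where "h C x = (SUP n. arctan (C n x))" for C :: "nat \<Rightarrow> 'a \<Rightarrow> real" and x
  define S where "S = {C :: nat \<Rightarrow> 'a \<Rightarrow> real. range C \<subseteq> A}"
  obtain f0 where f0: "f0 \<in> A" using ne by auto
  have bdd: "bdd_above (range (\<lambda>n. arctan (C n x)))" for C :: "nat \<Rightarrow> 'a \<Rightarrow> real" and x
    using arctan_ubound by (intro bdd_aboveI[where M = "pi/2"]) (auto intro: less_imp_le)
  have h_ge: "arctan (C n x) \<le> h C x" for C n x
    unfolding h_def by (rule cSUP_upper[OF _ bdd]) simp
  have h_le: "h C x \<le> c" if "\<And>n. arctan (C n x) \<le> c" for C x c
    unfolding h_def by (rule cSUP_least) (use that in auto)
  have h_lo: "- (pi/2) < h C x" for C x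
    using h_ge[of C 0 x] arctan_lbound[of "C 0 x"] by linarith
  have h_hi: "h C x \<le> pi/2" for C x
    using arctan_ubound by (intro h_le) (auto intro: less_imp_le)
  have h_meas: "h C \<in> borel_measurable M" if "C \<in> S" for C
  proof -
    have "C n \<in> borel_measurable M" for n using that meas unfolding S_def by auto
    then have "(\<lambda>x. arctan (C n x)) \<in> borel_measurable M" for n
      by (intro borel_measurable_continuous_on[where f = arctan] continuous_intros) auto
    then show ?thesis unfolding h_def
      by (intro borel_measurable_cSUP bdd) auto
  qed
  have h_int: "integrable M (h C)" if "C \<in> S" for C
  proof (rule integrable_const_bound[where B = "pi/2"])
    show "AE x in M. norm (h C x) \<le> pi/2"
    proof (rule AE_I2)
      fix x show "norm (h C x) \<le> pi/2"
        using h_lo[of C x] h_hi[of C x] unfolding real_norm_def by linarith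
    qed
  qed (rule h_meas[OF that])
  define I where "I C = integral\<^sup>L M (h C)" for C
  have Sne: "(\<lambda>_. f0) \<in> S" using f0 by (auto simp: S_def)
  have I_le: "I C \<le> pi/2" if "C \<in> S" for C
    unfolding I_def by (rule integral_le_const[OF h_int[OF that]]) (intro AE_I2 h_hi)
  have Ibdd: "bdd_above (I ` S)" using I_le by (intro bdd_aboveI[where M = "pi/2"]) auto
  define a where "a = (SUP C\<in>S. I C)"
  have "\<exists>C\<in>S. a - 1 / real (Suc k) < I C" for k
  proof -
    have "a - 1 / real (Suc k) < (SUP C\<in>S. I C)" unfolding a_def by simp
    then show ?thesis using less_cSUP_iff[OF _ Ibdd] Sne by blast
  qed
  then obtain C where C: "\<And>k. C k \<in> S" "\<And>k. a - 1 / real (Suc k) < I (C k)" by metis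
  define D where "D n = C (fst (prod_decode n)) (snd (prod_decode n))" for n
  have D: "D \<in> S" using C(1) by (auto simp: S_def D_def)
  have hCD: "h (C k) x \<le> h D x" for k x
  proof (rule h_le)
    fix n show "arctan (C k n x) \<le> h D x"
      using h_ge[of D "prod_encode (k, n)" x] by (simp add: D_def)
  qed
  have "a - 1 / real (Suc k) \<le> I D" for k
  proof -
    have "I (C k) \<le> I D" unfolding I_def by (intro integral_mono h_int C(1) D hCD)
    with C(2)[of k] show ?thesis by linarith
  qed
  moreover have "(\<lambda>k. a - 1 / real (Suc k)) \<longlonglongrightarrow> a - 0"
    by (intro tendsto_intros LIMSEQ_Suc[OF lim_1_over_n])
  ultimately have aD: "a \<le> I D" by (intro LIMSEQ_le_const2[where a = "I D"]) auto
  have dom: "AE x in M. arctan (f x) \<le> h D x" if "f \<in> A" for f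
  proof -
    define E where "E = case_nat f D"
    have "D n \<in> A" for n using D by (auto simp: S_def)
    then have "E n \<in> A" for n using that by (cases n) (simp_all add: E_def)
    then have E: "E \<in> S" by (auto simp: S_def)
    have hDE: "h D x \<le> h E x" for x
    proof (rule h_le)
      fix n show "arctan (D n x) \<le> h E x"
        using h_ge[of E "Suc n" x] by (simp add: E_def)
    qed
    have "I E \<le> a" unfolding a_def by (rule cSUP_upper[OF E Ibdd])
    moreover have "I D \<le> I E" unfolding I_def by (intro integral_mono h_int E D hDE)
    ultimately have "I E - I D = 0" using aD by linarith
    then have "integral\<^sup>L M (\<lambda>x. h E x - h D x) = 0"
      unfolding I_def by (subst Bochner_Integration.integral_diff) (auto intro: h_int E D)
    then have "AE x in M. h E x - h D x = 0"
      by (subst (asm) integral_nonneg_eq_0_iff_AE)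
         (auto intro!: Bochner_Integration.integrable_diff h_int E D simp: hDE)
    then show ?thesis
    proof eventually_elim
      case (elim x)
      then show ?case using h_ge[of E 0 x] by (simp add: E_def)
    qed
  qed
  have DA: "D n \<in> A" for n using D by (auto simp: S_def)
  have "AE x in M. \<forall>n. D n x \<le> g x" using g(2)[OF DA] by (simp add: AE_all_countable)
  then have hlt: "AE x in M. h D x < pi/2"
  proof eventually_elim
    case (elim x)
    then have "h D x \<le> arctan (g x)" by (intro h_le) (auto simp: arctan_le_iff)
    then show ?case using arctan_ubound[of "g x"] by linarith
  qed
  define Y where "Y x = tan (h D x)" for x
  have "is_family_esssup M A Y"
    unfolding is_family_esssup_def
  proof (intro conjI ballI impI)
    show "Y \<in> borel_measurable M"
      unfolding Y_def tan_def using h_meas[OF D] by measurable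
  next
    fix f assume "f \<in> A"
    from dom[OF this] hlt show "AE x in M. f x \<le> Y x"
    proof eventually_elim
      case (elim x)
      have "tan (arctan (f x)) \<le> tan (h D x)"
        using elim arctan_lbound[of "f x"] by (intro tan_mono_le) auto
      then show ?case by (simp add: Y_def tan_arctan)
    qed
  next
    fix Z :: "'a \<Rightarrow> real" assume Z: "\<forall>f\<in>A. AE x in M. f x \<le> Z x"
    have "AE x in M. \<forall>n. D n x \<le> Z x" using Z DA by (simp add: AE_all_countable)
    then show "AE x in M. Y x \<le> Z x"
    proof eventually_elim
      case (elim x)
      then have "h D x \<le> arctan (Z x)" by (intro h_le) (auto simp: arctan_le_iff)
      then have "tan (h D x) \<le> tan (arctan (Z x))"
        using h_lo[of D x] arctan_ubound[of "Z x"] by (intro tan_mono_le) auto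
      then show ?case by (simp add: Y_def tan_arctan)
    qed
  qed
  then show ?thesis unfolding family_esssup_def by (rule someI[of "is_family_esssup M A"])
qed


section \<open>Wiener process and stochastic integral\<close>

definition generated_filtration :: "'a measure \<Rightarrow> (real \<Rightarrow> 'a \<Rightarrow> real) \<Rightarrow> real \<Rightarrow> 'a measure" where
  "generated_filtration M X t =
     sigma (space M) {X s -` A \<inter> space M | s A. s \<in> {0..t} \<and> A \<in> sets borel}"

definition augmented_filtration :: "'a measure \<Rightarrow> (real \<Rightarrow> 'a \<Rightarrow> real) \<Rightarrow> real \<Rightarrow> 'a measure" where
  "augmented_filtration M X t =
     sigma (space M)
       ({X s -` A \<inter> space M | s A. s \<in> {0..t} \<and> A \<in> sets borel} \<union> null_sets M)"

definition wiener_process :: "'a measure \<Rightarrow> (real \<Rightarrow> 'a \<Rightarrow> real) \<Rightarrow> bool" where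
  "wiener_process M W \<longleftrightarrow>
     (\<forall>t\<ge>0. W t \<in> borel_measurable M) \<and>
     (AE \<omega> in M. W 0 \<omega> = 0) \<and>
     (\<forall>s\<ge>0. \<forall>t>s. distributed M lborel (\<lambda>\<omega>. W t \<omega> - W s \<omega>) (normal_density 0 (sqrt (t - s)))) \<and>
     (\<forall>n (t :: nat \<Rightarrow> real). 0 \<le> t 0 \<and> strict_mono_on {..n} t \<longrightarrow>
        prob_space.indep_vars M (\<lambda>_. borel) (\<lambda>k \<omega>. W (t (Suc k)) \<omega> - W (t k) \<omega>) {..<n}) \<and>
     (AE \<omega> in M. continuous_on {0..} (\<lambda>t. W t \<omega>))"

definition progressively_measurable ::
    "(real \<Rightarrow> 'a measure) \<Rightarrow> real \<Rightarrow> (real \<Rightarrow> 'a \<Rightarrow> real) \<Rightarrow> bool" where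
  "progressively_measurable F T H \<longleftrightarrow>
     (\<forall>t\<in>{0..T}. (\<lambda>(s, \<omega>). H s \<omega>) \<in> borel_measurable (restrict_space borel {0..t} \<Otimes>\<^sub>M F t))"

text \<open>\<open>(n, p, \<xi>)\<close> encodes the simple integrand that equals \<open>\<xi> k\<close> on the interval from \<open>p k\<close>
  (excluded) to \<open>p (Suc k)\<close> (included), for \<open>k < n\<close>.\<close>

type_synonym 'a simple_integrand = "nat \<times> (nat \<Rightarrow> real) \<times> (nat \<Rightarrow> 'a \<Rightarrow> real)"

fun is_simple_integrand :: "(real \<Rightarrow> 'a measure) \<Rightarrow> real \<Rightarrow> 'a simple_integrand \<Rightarrow> bool" where
  "is_simple_integrand F T (n, p, \<xi>) \<longleftrightarrow>
     p ` {..n} \<subseteq> {0..T} \<and> mono_on {..n} p \<and>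
     (\<forall>k<n. \<xi> k \<in> borel_measurable (F (p k)) \<and> (\<exists>c. \<forall>\<omega>\<in>space (F (p k)). \<bar>\<xi> k \<omega>\<bar> \<le> c))"

fun simple_path :: "'a simple_integrand \<Rightarrow> real \<Rightarrow> 'a \<Rightarrow> real" where
  "simple_path (n, p, \<xi>) t \<omega> = (\<Sum>k<n. \<xi> k \<omega> * indicator {p k<..p (Suc k)} t)"

fun simple_integral :: "(real \<Rightarrow> 'a \<Rightarrow> real) \<Rightarrow> 'a simple_integrand \<Rightarrow> real \<Rightarrow> 'a \<Rightarrow> real" where
  "simple_integral W (n, p, \<xi>) t \<omega> =
     (\<Sum>k<n. \<xi> k \<omega> * (W (min t (p (Suc k))) \<omega> - W (min t (p k)) \<omega>))"

text \<open>\<open>I\<close> is a continuous version of the Ito integral process of \<open>H\<close> against \<open>W\<close> on the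
  time interval up to \<open>T\<close>: \<open>H\<close> is progressive with almost surely square integrable paths, and
  \<open>I\<close> is the limit in probability of the integrals of simple integrands that approximate \<open>H\<close>
  pathwise in the square mean, in probability.\<close>

definition is_ito_integral ::
    "'a measure \<Rightarrow> (real \<Rightarrow> 'a measure) \<Rightarrow> (real \<Rightarrow> 'a \<Rightarrow> real) \<Rightarrow> real \<Rightarrow>
     (real \<Rightarrow> 'a \<Rightarrow> real) \<Rightarrow> (real \<Rightarrow> 'a \<Rightarrow> real) \<Rightarrow> bool" where
  "is_ito_integral M F W T H I \<longleftrightarrow>
     progressively_measurable F T H \<and>
     (AE \<omega> in M. (\<integral>\<^sup>+u\<in>{0..T}. ennreal ((H u \<omega>)\<^sup>2) \<partial>lborel) < \<infinity>) \<and>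
     (\<forall>t\<in>{0..T}. I t \<in> borel_measurable (F t)) \<and>
     (AE \<omega> in M. continuous_on {0..T} (\<lambda>t. I t \<omega>)) \<and>
     (\<exists>Z :: nat \<Rightarrow> 'a simple_integrand.
        (\<forall>m. is_simple_integrand F T (Z m)) \<and>
        (\<forall>\<epsilon>>0. (\<lambda>m. measure M {\<omega>\<in>space M.
             (\<integral>\<^sup>+u\<in>{0..T}. ennreal ((simple_path (Z m) u \<omega> - H u \<omega>)\<^sup>2) \<partial>lborel) > ennreal \<epsilon>})
           \<longlonglongrightarrow> 0) \<and>
        (\<forall>t\<in>{0..T}. \<forall>\<epsilon>>0. (\<lambda>m. measure M {\<omega>\<in>space M.
             \<bar>simple_integral W (Z m) t \<omega> - I t \<omega>\<bar> > \<epsilon>}) \<longlonglongrightarrow> 0))"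


section \<open>The price model\<close>

text \<open>\<open>y\<close> stands for a path of the log-price.\<close>

definition log_price_average :: "real \<Rightarrow> real \<Rightarrow> (real \<Rightarrow> real) \<Rightarrow> real \<Rightarrow> real" where
  "log_price_average \<alpha> \<delta> y t =
     (1 - \<alpha>) * (LBINT u:{0..t}. y u / ((t + \<delta>) powr (1 - \<alpha>) * (t - u + \<delta>) powr \<alpha>))
       + y t * of_bool (\<alpha> = 1)"

definition price_trend :: "real \<Rightarrow> real \<Rightarrow> (real \<Rightarrow> real) \<Rightarrow> real \<Rightarrow> real" where
  "price_trend \<alpha> \<delta> y t =
     (1 - \<alpha>) * (LBINT u:{0..t}. (y u - y t) / ((t + \<delta>) powr (1 - \<alpha>) * (t - u + \<delta>) powr \<alpha>))"

definition volatility ::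
    "real \<Rightarrow> real \<Rightarrow> real \<Rightarrow> real \<Rightarrow> real \<Rightarrow> (real \<Rightarrow> real) \<Rightarrow>
     (real \<Rightarrow> real) \<Rightarrow> (real \<Rightarrow> real) \<Rightarrow> real \<Rightarrow> real" where
  "volatility \<alpha> \<delta> V0 V1 V2 P y x t =
     V0 + V1 / ((x t + P t) * (1 - x t - P t) + \<delta>)
        + V2 * sqrt (\<bar>log_price_average \<alpha> \<delta> y t - y 0\<bar> + \<delta>)"

definition storage_drift ::
    "real \<Rightarrow> real \<Rightarrow> real \<Rightarrow> real \<Rightarrow> (real \<Rightarrow> real) \<Rightarrow>
     (real \<Rightarrow> real) \<Rightarrow> (real \<Rightarrow> real) \<Rightarrow> real \<Rightarrow> real" where
  "storage_drift \<alpha> \<delta> \<gamma>1 \<gamma>2 P y x t =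
     \<gamma>1 * max 0 (price_trend \<alpha> \<delta> y t) * (1 - x t - P t)
       - \<gamma>2 * max 0 (- price_trend \<alpha> \<delta> y t) * (x t + P t)"

text \<open>\<open>(Y, X)\<close> is a continuous adapted solution, up to time \<open>T\<close>, of the log-price and storage
  equations with initial values \<open>y0\<close> and \<open>x0\<close> and normalized storage \<open>X + P\<close> in \<open>(0, 1]\<close>.\<close>

definition price_storage_solution ::
    "'a measure \<Rightarrow> (real \<Rightarrow> 'a measure) \<Rightarrow> (real \<Rightarrow> 'a \<Rightarrow> real) \<Rightarrow> real \<Rightarrow>
     real \<Rightarrow> real \<Rightarrow> real \<Rightarrow> real \<Rightarrow> real \<Rightarrow> real \<Rightarrow> real \<Rightarrow> real \<Rightarrow> real \<Rightarrow>
     (real \<Rightarrow> real) \<Rightarrow> real \<Rightarrow> real \<Rightarrow> (real \<Rightarrow> 'a \<Rightarrow> real) \<Rightarrow> (real \<Rightarrow> 'a \<Rightarrow> real) \<Rightarrow> bool" where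
  "price_storage_solution M F W T \<alpha> \<delta> lam r V0 V1 V2 \<gamma>1 \<gamma>2 P y0 x0 Y X \<longleftrightarrow>
     (\<forall>t\<in>{0..T}. Y t \<in> borel_measurable (F t) \<and> X t \<in> borel_measurable (F t)) \<and>
     (AE \<omega> in M. continuous_on {0..T} (\<lambda>t. Y t \<omega>) \<and> continuous_on {0..T} (\<lambda>t. X t \<omega>)) \<and>
     (AE \<omega> in M. Y 0 \<omega> = y0 \<and> X 0 \<omega> = x0) \<and>
     (AE \<omega> in M. \<forall>t\<in>{0..T}. 0 < X t \<omega> + P t \<and> X t \<omega> + P t \<le> 1) \<and>
     (let \<sigma> = (\<lambda>t \<omega>. volatility \<alpha> \<delta> V0 V1 V2 P (\<lambda>u. Y u \<omega>) (\<lambda>u. X u \<omega>) t);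
          d = (\<lambda>t \<omega>. storage_drift \<alpha> \<delta> \<gamma>1 \<gamma>2 P (\<lambda>u. Y u \<omega>) (\<lambda>u. X u \<omega>) t)
      in (\<exists>I. is_ito_integral M F W T \<sigma> I \<and>
            (AE \<omega> in M.
               set_integrable lborel {0..T} (\<lambda>u. r - (\<sigma> u \<omega>)\<^sup>2 / 2 - lam * Y u \<omega>) \<and>
               (\<forall>t\<in>{0..T}. Y t \<omega> =
                  Y 0 \<omega> + (LBINT u:{0..t}. r - (\<sigma> u \<omega>)\<^sup>2 / 2 - lam * Y u \<omega>) + I t \<omega>))) \<and>
         (AE \<omega> in M.
            set_integrable lborel {0..T} (\<lambda>u. d u \<omega>) \<and>
            (\<forall>t\<in>{0..T}. X t \<omega> = X 0 \<omega> + (LBINT u:{0..t}. d u \<omega>))))"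


section \<open>The swing option\<close>

text \<open>In this section \<open>FS\<close> is the filtration generated by the price \<open>S\<close>, the exercise times are
  \<open>\<tau> 0, \<dots>, \<tau> m\<close>, the maturity is \<open>\<tau> (Suc m)\<close>, and \<open>Lloc\<close> is the local limit on
  exercised rights.\<close>

definition admissible_controls ::
    "'a measure \<Rightarrow> (real \<Rightarrow> 'a measure) \<Rightarrow> nat \<Rightarrow> (nat \<Rightarrow> real) \<Rightarrow> nat \<Rightarrow> (real \<Rightarrow> 'a \<Rightarrow> nat) set" where
  "admissible_controls M FS m \<tau> Lloc =
     {q. \<forall>t\<in>\<tau> ` {0..m}. q t \<in> FS t \<rightarrow>\<^sub>M count_space UNIV \<and> (\<forall>\<omega>\<in>space M. q t \<omega> \<in> {0..Lloc})}"

text \<open>\<open>remaining_rights \<tau> q i Q k\<close> is the number of rights remaining at \<open>\<tau> (i + k)\<close> when \<open>Q\<close>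
  rights remain at \<open>\<tau> i\<close>; an attempt to exercise more rights than remain has no effect.\<close>

primrec remaining_rights ::
    "(nat \<Rightarrow> real) \<Rightarrow> (real \<Rightarrow> 'a \<Rightarrow> nat) \<Rightarrow> nat \<Rightarrow> ('a \<Rightarrow> nat) \<Rightarrow> nat \<Rightarrow> 'a \<Rightarrow> nat" where
  "remaining_rights \<tau> q i Q 0 \<omega> = Q \<omega>"
| "remaining_rights \<tau> q i Q (Suc k) \<omega> =
     remaining_rights \<tau> q i Q k \<omega>
       - q (\<tau> (i + k)) \<omega> * of_bool (q (\<tau> (i + k)) \<omega> \<le> remaining_rights \<tau> q i Q k \<omega>)"

definition swing_reward ::
    "'a measure \<Rightarrow> (real \<Rightarrow> 'a measure) \<Rightarrow> (real \<Rightarrow> 'a \<Rightarrow> real) \<Rightarrow> real \<Rightarrow> real \<Rightarrow> nat \<Rightarrow> (nat \<Rightarrow> real) \<Rightarrow>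
     (real \<Rightarrow> nat \<Rightarrow> real) \<Rightarrow> nat \<Rightarrow> ('a \<Rightarrow> nat) \<Rightarrow> (real \<Rightarrow> 'a \<Rightarrow> nat) \<Rightarrow> 'a \<Rightarrow> real" where
  "swing_reward M FS S K \<mu> m \<tau> G i Q q =
     real_cond_exp M (FS (\<tau> i)) (\<lambda>\<omega>.
       (\<Sum>j=i..m. exp (- \<mu> * (\<tau> j - \<tau> i)) * real (q (\<tau> j) \<omega>) * max 0 (K - S (\<tau> j) \<omega>)
            * of_bool (q (\<tau> j) \<omega> \<le> remaining_rights \<tau> q i Q (j - i) \<omega>))
       + exp (- \<mu> * (\<tau> (Suc m) - \<tau> i))
           * G (S (\<tau> (Suc m)) \<omega>) (remaining_rights \<tau> q i Q (Suc m - i) \<omega>))"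

definition swing_value ::
    "'a measure \<Rightarrow> (real \<Rightarrow> 'a measure) \<Rightarrow> (real \<Rightarrow> 'a \<Rightarrow> real) \<Rightarrow> real \<Rightarrow> real \<Rightarrow> nat \<Rightarrow> (nat \<Rightarrow> real) \<Rightarrow>
     nat \<Rightarrow> (real \<Rightarrow> nat \<Rightarrow> real) \<Rightarrow> nat \<Rightarrow> ('a \<Rightarrow> nat) \<Rightarrow> 'a \<Rightarrow> real" where
  "swing_value M FS S K \<mu> m \<tau> Lloc G i Q =
     (if i \<le> m
      then family_esssup M (swing_reward M FS S K \<mu> m \<tau> G i Q ` admissible_controls M FS m \<tau> Lloc)
      else (\<lambda>\<omega>. G (S (\<tau> (Suc m)) \<omega>) (Q \<omega>)))"

end

theory Submission
  imports Defs
begin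

text \<open>Only finitely many rights can be exercised at each of finitely many dates, so backward
  induction produces a dominating value function: with no date to go it is the penalty, and with
  one more date to go it is the pointwise maximum over \<open>u\<close> of the immediate payoff plus the
  discounted conditional expectation of the previous value at \<open>l - u\<close> remaining rights.
  The least maximiser is a measurable selection. Hence both essential suprema are attained, and
  both coincide almost surely with the value function evaluated at the random number of remaining
  rights.\<close>

section \<open>Essential suprema attained by a member of the family\<close>

text \<open>Any competing upper bound must dominate \<open>h0\<close>, hence also \<open>f\<close>,
  so \<open>f\<close> is itself an essential supremum. It witnesses the choice in
  \<open>family_esssup\<close>, and uniqueness up to null sets identifies the chosen version with
  it.\<close>

lemma family_esssup_attained:
  assumes f: "f \<in> borel_measurable M" and ub: "\<And>h. h \<in> A \<Longrightarrow> AE x in M. h x \<le> f x"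
    and h0: "h0 \<in> A" "AE x in M. h0 x = f x"
  shows "family_esssup M A \<in> borel_measurable M" "AE x in M. family_esssup M A x = f x"
proof -
  have *: "is_family_esssup M A f"
    unfolding is_family_esssup_def
  proof (intro conjI ballI impI f ub)
    fix Z assume "\<forall>h\<in>A. AE x in M. h x \<le> Z x"
    then have "AE x in M. h0 x \<le> Z x" using h0 by blast
    with h0(2) show "AE x in M. f x \<le> Z x" by eventually_elim simp
  qed
  then have "is_family_esssup M A (family_esssup M A)"
    unfolding family_esssup_def by (rule someI[where P = "is_family_esssup M A"])
  then show "family_esssup M A \<in> borel_measurable M" "AE x in M. family_esssup M A x = f x"
    using is_family_esssup_unique[OF _ *] by (auto simp: is_family_esssup_def)
qed

section \<open>Measurability and conditioning with a random integer index\<close>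

lemma nat_diff_measurable:
  fixes f g :: "'a \<Rightarrow> nat"
  assumes [measurable]: "f \<in> M \<rightarrow>\<^sub>M count_space UNIV" "g \<in> M \<rightarrow>\<^sub>M count_space UNIV"
  shows "(\<lambda>x. f x - g x) \<in> M \<rightarrow>\<^sub>M count_space UNIV"
  by measurable

text \<open>For each of the countably many values of \<open>f\<close> what remains is a function of
  \<open>g\<close> alone, and every function on a discrete space is measurable.\<close>

lemma nat_if_le_measurable:
  fixes f g :: "'a \<Rightarrow> nat"
  assumes f: "f \<in> M \<rightarrow>\<^sub>M count_space UNIV" and g: "g \<in> M \<rightarrow>\<^sub>M count_space UNIV"
  shows "(\<lambda>x. if f x \<le> g x then f x else 0) \<in> M \<rightarrow>\<^sub>M count_space UNIV"
  by (rule measurable_compose_countable[OF measurable_compose[OF g] f]) simp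

context sigma_finite_subalgebra
begin

text \<open>Since \<open>Z\<close> is bounded by \<open>N\<close>, the function is a finite sum of
  restrictions of integrable functions to the level sets of \<open>Z\<close>.\<close>

lemma integrable_finite_choice:
  fixes f :: "nat \<Rightarrow> 'a \<Rightarrow> real"
  assumes Z: "Z \<in> F \<rightarrow>\<^sub>M count_space UNIV" "\<And>x. x \<in> space M \<Longrightarrow> Z x \<le> N"
    and f: "\<And>l. l \<le> N \<Longrightarrow> integrable M (f l)"
  shows "integrable M (\<lambda>x. f (Z x) x)"
proof -
  have [measurable]: "Z \<in> M \<rightarrow>\<^sub>M count_space UNIV" using measurable_from_subalg[OF subalg Z(1)] .
  have "integrable M (\<lambda>x. \<Sum>l\<le>N. indicator {x \<in> space M. Z x = l} x * f l x)"
  proof (intro Bochner_Integration.integrable_sum)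
    fix l assume "l \<in> {..N}"
    moreover have "{x \<in> space M. Z x = l} \<in> sets M" by measurable
    ultimately show "integrable M (\<lambda>x. indicator {x \<in> space M. Z x = l} x * f l x)"
      using integrable_mult_indicator[OF _ f[of l]] by simp
  qed
  moreover have "f (Z x) x = (\<Sum>l\<le>N. indicator {x \<in> space M. Z x = l} x * f l x)"
    if "x \<in> space M" for x
  proof -
    have "(\<Sum>l\<le>N. indicator {x \<in> space M. Z x = l} x * f l x) = (\<Sum>l\<le>N. if l = Z x then f l x else 0)"
      using that by (intro sum.cong) auto
    then show ?thesis using Z(2)[OF that] by simp
  qed
  ultimately show ?thesis
    by (subst Bochner_Integration.integrable_cong[OF refl]) auto
qed

text \<open>Localise to the finitely many events \<open>Z = l\<close>, which belong to
  \<open>F\<close>. On the right the index sits outside the conditioning: each \<open>f l\<close> is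
  conditioned on its own and the result is evaluated at \<open>Z x\<close>. This is how values for a
  fixed number of rights yield values for a random number.\<close>

lemma real_cond_exp_finite_choice:
  fixes f :: "nat \<Rightarrow> 'a \<Rightarrow> real"
  assumes Z: "Z \<in> F \<rightarrow>\<^sub>M count_space UNIV" "\<And>x. x \<in> space M \<Longrightarrow> Z x \<le> N"
    and f: "\<And>l. l \<le> N \<Longrightarrow> integrable M (f l)"
  shows "AE x in M. real_cond_exp M F (\<lambda>x. f (Z x) x) x = real_cond_exp M F (f (Z x)) x"
proof -
  note [measurable] = Z(1)
  have sp: "space F = space M" using subalg by (simp add: subalgebra_def)
  note int = integrable_finite_choice[OF assms]
  have "AE x in M. Z x = l \<longrightarrow> real_cond_exp M F (\<lambda>x. f (Z x) x) x = real_cond_exp M F (f l) x"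
    if l: "l \<le> N" for l
  proof -
    define I :: "'a \<Rightarrow> real" where "I = indicator {x \<in> space F. Z x = l}"
    have AF: "{x \<in> space F. Z x = l} \<in> sets F" by measurable
    then have AM: "{x \<in> space F. Z x = l} \<in> sets M" using subalg unfolding subalgebra_def by blast
    have I: "I \<in> borel_measurable F" unfolding I_def using AF by measurable
    \<comment> \<open>The products agree everywhere, so after rewriting the two pull-out identities
      below compute one and the same conditional expectation.\<close>
    have eq: "I x * f (Z x) x = I x * f l x" for x by (auto simp: I_def split: split_indicator)
    have 1: "integrable M (\<lambda>x. I x * f l x)" "integrable M (\<lambda>x. I x * f (Z x) x)"
      unfolding I_def using integrable_mult_indicator[OF AM f[OF l]]
        integrable_mult_indicator[OF AM int] by simp_all
    have "AE x in M. real_cond_exp M F (\<lambda>x. I x * f l x) x = I x * real_cond_exp M F (f l) x"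
      using f[OF l] by (intro real_cond_exp_mult I 1) auto
    moreover have "AE x in M. real_cond_exp M F (\<lambda>x. I x * f (Z x) x) x
        = I x * real_cond_exp M F (\<lambda>x. f (Z x) x) x"
      using int by (intro real_cond_exp_mult I 1) auto
    ultimately show ?thesis
      using AE_space unfolding eq
      by eventually_elim (auto simp: I_def sp)
  qed
  then have "AE x in M. \<forall>l\<in>{..N}. Z x = l \<longrightarrow>
      real_cond_exp M F (\<lambda>x. f (Z x) x) x = real_cond_exp M F (f l) x"
    by (intro AE_finite_allI) auto
  with AE_space show ?thesis
    by eventually_elim (use Z(2) in auto)
qed

end

section \<open>The recursion for the remaining rights\<close>

text \<open>The defining recursion peels off the last date, whereas backward induction removes the
  first one; the state is therefore restarted one date later.\<close>

lemma remaining_rights_Suc_left: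
  "remaining_rights \<tau> q i R (Suc k) \<omega> =
   remaining_rights \<tau> q (Suc i) (\<lambda>\<omega>. R \<omega> - q (\<tau> i) \<omega> * of_bool (q (\<tau> i) \<omega> \<le> R \<omega>)) k \<omega>"
  by (induction k) simp_all

lemma remaining_rights_cong:
  "(\<And>n. n < k \<Longrightarrow> q (\<tau> (i + n)) \<omega> = q' (\<tau> (i + n)) \<omega>) \<Longrightarrow>
   remaining_rights \<tau> q i R k \<omega> = remaining_rights \<tau> q' i R k \<omega>"
  by (induction k) simp_all

section \<open>The contract over an adapted nonnegative price\<close>

text \<open>What the backward induction uses of the model: nested sigma-algebras along the dates, an
  adapted nonnegative price, which makes the put payoff bounded, and an integrable penalty. Controls
  are indexed by real time, so \<open>\<tau>_inj\<close> ensures that changing one at a date leaves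
  the other dates alone.\<close>

locale swing_contract = prob_space M
  for M :: "'a measure" and FS :: "real \<Rightarrow> 'a measure" and S :: "real \<Rightarrow> 'a \<Rightarrow> real"
    and K \<mu> :: real and m :: nat and \<tau> :: "nat \<Rightarrow> real" and L Lloc :: nat
    and G :: "real \<Rightarrow> nat \<Rightarrow> real" +
  assumes subalg: "j \<le> Suc m \<Longrightarrow> subalgebra M (FS (\<tau> j))"
    and subalg_Suc: "j \<le> m \<Longrightarrow> subalgebra (FS (\<tau> (Suc j))) (FS (\<tau> j))"
    and price_measurable: "j \<le> Suc m \<Longrightarrow> S (\<tau> j) \<in> borel_measurable (FS (\<tau> j))"
    and price_nonneg: "0 \<le> S t \<omega>"
    and \<tau>_inj: "inj_on \<tau> {0..Suc m}"
    and penalty_measurable: "(\<lambda>x. G x l) \<in> borel_measurable borel"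
    and penalty_integrable: "l \<le> L \<Longrightarrow> integrable M (\<lambda>\<omega>. G (S (\<tau> (Suc m)) \<omega>) l)"
begin

abbreviation payoff :: "nat \<Rightarrow> 'a \<Rightarrow> real" where
  "payoff i \<omega> \<equiv> max 0 (K - S (\<tau> i) \<omega>)"

abbreviation discount :: "nat \<Rightarrow> real" where
  "discount i \<equiv> exp (- \<mu> * (\<tau> (Suc i) - \<tau> i))"

abbreviation controls :: "(real \<Rightarrow> 'a \<Rightarrow> nat) set" where
  "controls \<equiv> admissible_controls M FS m \<tau> Lloc"

text \<open>The random states allowed in the value functional; the bound \<open>L\<close> turns
  every evaluation at \<open>R\<close> into a finite choice.\<close>

definition rights_at :: "nat \<Rightarrow> ('a \<Rightarrow> nat) \<Rightarrow> bool" where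
  "rights_at i R \<longleftrightarrow> R \<in> FS (\<tau> i) \<rightarrow>\<^sub>M count_space UNIV \<and> (\<forall>\<omega>\<in>space M. R \<omega> \<le> L)"

text \<open>The random variable inside \<open>swing_reward\<close>, named before conditioning so
  that it can be split pathwise. For \<open>i = Suc m\<close> the sum is empty and only the penalty
  remains.\<close>

definition cash_flow :: "nat \<Rightarrow> ('a \<Rightarrow> nat) \<Rightarrow> (real \<Rightarrow> 'a \<Rightarrow> nat) \<Rightarrow> 'a \<Rightarrow> real" where
  "cash_flow i R q \<omega> =
     (\<Sum>j=i..m. exp (- \<mu> * (\<tau> j - \<tau> i)) * real (q (\<tau> j) \<omega>) * payoff j \<omega>
          * of_bool (q (\<tau> j) \<omega> \<le> remaining_rights \<tau> q i R (j - i) \<omega>))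
     + exp (- \<mu> * (\<tau> (Suc m) - \<tau> i))
         * G (S (\<tau> (Suc m)) \<omega>) (remaining_rights \<tau> q i R (Suc m - i) \<omega>)"

text \<open>The first argument is the number of exercise dates to go, so that \<open>value_fn k\<close> belongs to
  the date \<open>\<tau> (Suc m - k)\<close>.\<close>

primrec value_fn :: "nat \<Rightarrow> nat \<Rightarrow> 'a \<Rightarrow> real" where
  "value_fn 0 = (\<lambda>l \<omega>. G (S (\<tau> (Suc m)) \<omega>) l)"
| "value_fn (Suc k) = (\<lambda>l \<omega>. MAX u\<in>{0..min Lloc l}.
     real u * payoff (m - k) \<omega>
       + discount (m - k) * real_cond_exp M (FS (\<tau> (m - k))) (value_fn k (l - u)) \<omega>)"

lemma sigma_finite_FS: "j \<le> Suc m \<Longrightarrow> sigma_finite_subalgebra M (FS (\<tau> j))"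
  using subalg
  by (intro finite_measure_subalgebra_is_sigma_finite
      finite_measure_subalgebra.intro finite_measure_axioms finite_measure_subalgebra_axioms.intro)

lemma payoff_measurable: "j \<le> Suc m \<Longrightarrow> payoff j \<in> borel_measurable (FS (\<tau> j))"
  using price_measurable by measurable

lemma payoff_integrable: "j \<le> Suc m \<Longrightarrow> integrable M (payoff j)"
\<comment> \<open>A put on a nonnegative price pays between \<open>0\<close> and
  \<open>max 0 K\<close>; the absolute value covers either sign of \<open>K\<close>.\<close>
proof (rule integrable_const_bound[where B = "\<bar>K\<bar>"])
  show "AE \<omega> in M. norm (payoff j \<omega>) \<le> \<bar>K\<bar>"
  proof (rule AE_I2)
    fix \<omega>
    show "norm (payoff j \<omega>) \<le> \<bar>K\<bar>" using price_nonneg[of "\<tau> j" \<omega>] by auto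
  qed
qed (rule measurable_from_subalg[OF subalg payoff_measurable])

text \<open>What is known at \<open>\<tau> i\<close> is known one date later, and truncated
  subtraction keeps the bound \<open>L\<close> for any \<open>u\<close>.\<close>

lemma rights_at_Suc:
  assumes "i \<le> m" "rights_at i R" "u \<in> FS (\<tau> i) \<rightarrow>\<^sub>M count_space UNIV"
  shows "rights_at (Suc i) (\<lambda>\<omega>. R \<omega> - u \<omega>)"
proof -
  have "(\<lambda>\<omega>. R \<omega> - u \<omega>) \<in> FS (\<tau> i) \<rightarrow>\<^sub>M count_space UNIV"
    using assms(2,3) unfolding rights_at_def by (auto intro: nat_diff_measurable)
  from measurable_from_subalg[OF subalg_Suc[OF assms(1)] this] assms(2) show ?thesis
    by (auto simp: rights_at_def intro: le_trans[OF diff_le_self])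
qed

lemma effective_exercise_measurable:
  assumes "i \<le> m" "rights_at i R" "q \<in> controls"
  shows "(\<lambda>\<omega>. q (\<tau> i) \<omega> * of_bool (q (\<tau> i) \<omega> \<le> R \<omega>)) \<in> FS (\<tau> i) \<rightarrow>\<^sub>M count_space UNIV"
proof -
  have "(\<lambda>\<omega>. if q (\<tau> i) \<omega> \<le> R \<omega> then q (\<tau> i) \<omega> else 0) \<in> FS (\<tau> i) \<rightarrow>\<^sub>M count_space UNIV"
    using assms by (intro nat_if_le_measurable) (auto simp: admissible_controls_def rights_at_def)
  then show ?thesis by (simp add: of_bool_def if_distrib cong: if_cong)
qed

section \<open>Splitting the cash flow at its first date\<close>

lemma cash_flow_maturity: "cash_flow (Suc m) R q \<omega> = G (S (\<tau> (Suc m)) \<omega>) (R \<omega>)"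
  by (simp add: cash_flow_def)

text \<open>Measuring time from \<open>\<tau> (Suc i)\<close> takes the factor
  \<open>discount i\<close> out of every later term, and restarting the rights there turns the later
  terms into a cash flow of the same form. The first term absorbs its indicator into the exercise
  that takes effect.\<close>

lemma cash_flow_step:
  assumes "i \<le> m"
  shows "cash_flow i R q \<omega> =
    real (q (\<tau> i) \<omega> * of_bool (q (\<tau> i) \<omega> \<le> R \<omega>)) * payoff i \<omega>
      + discount i * cash_flow (Suc i) (\<lambda>\<omega>. R \<omega> - q (\<tau> i) \<omega> * of_bool (q (\<tau> i) \<omega> \<le> R \<omega>)) q \<omega>"
proof -
  let ?R' = "\<lambda>\<omega>. R \<omega> - q (\<tau> i) \<omega> * of_bool (q (\<tau> i) \<omega> \<le> R \<omega>)"
  \<comment> \<open>There is no upper bound on \<open>j\<close>: the identity serves both the sum,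
    where \<open>j \<le> m\<close>, and the penalty, where \<open>j = Suc m\<close>.\<close>
  have rr: "remaining_rights \<tau> q i R (j - i) \<omega> = remaining_rights \<tau> q (Suc i) ?R' (j - Suc i) \<omega>"
    if "Suc i \<le> j" for j
    using remaining_rights_Suc_left[of \<tau> q i R "j - Suc i" \<omega>] that by (simp add: Suc_diff_Suc)
  have ee: "exp (- \<mu> * (\<tau> j - \<tau> i)) = discount i * exp (- \<mu> * (\<tau> j - \<tau> (Suc i)))" for j
    by (simp add: exp_add[symmetric] algebra_simps)
  have "(\<Sum>j=Suc i..m. exp (- \<mu> * (\<tau> j - \<tau> i)) * real (q (\<tau> j) \<omega>) * payoff j \<omega>
          * of_bool (q (\<tau> j) \<omega> \<le> remaining_rights \<tau> q i R (j - i) \<omega>))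
      = discount i * (\<Sum>j=Suc i..m. exp (- \<mu> * (\<tau> j - \<tau> (Suc i))) * real (q (\<tau> j) \<omega>) * payoff j \<omega>
          * of_bool (q (\<tau> j) \<omega> \<le> remaining_rights \<tau> q (Suc i) ?R' (j - Suc i) \<omega>))"
    unfolding sum_distrib_left
  proof (intro sum.cong refl)
    fix j assume "j \<in> {Suc i..m}"
    then have *: "Suc i \<le> j" by simp
    show "exp (- \<mu> * (\<tau> j - \<tau> i)) * real (q (\<tau> j) \<omega>) * payoff j \<omega>
          * of_bool (q (\<tau> j) \<omega> \<le> remaining_rights \<tau> q i R (j - i) \<omega>) =
        discount i * (exp (- \<mu> * (\<tau> j - \<tau> (Suc i))) * real (q (\<tau> j) \<omega>) * payoff j \<omega>
          * of_bool (q (\<tau> j) \<omega> \<le> remaining_rights \<tau> q (Suc i) ?R' (j - Suc i) \<omega>))"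
      unfolding rr[OF *] ee[of j] by (simp only: mult.assoc)
  qed
  moreover have "exp (- \<mu> * (\<tau> (Suc m) - \<tau> i))
        * G (S (\<tau> (Suc m)) \<omega>) (remaining_rights \<tau> q i R (Suc m - i) \<omega>)
      = discount i * (exp (- \<mu> * (\<tau> (Suc m) - \<tau> (Suc i)))
        * G (S (\<tau> (Suc m)) \<omega>) (remaining_rights \<tau> q (Suc i) ?R' (Suc m - Suc i) \<omega>))"
    unfolding ee[of "Suc m"] using assms rr[of "Suc m"] by (simp only: mult.assoc Suc_le_mono)
  ultimately show ?thesis
    unfolding cash_flow_def sum.atLeast_Suc_atMost[OF assms]
    by (simp add: distrib_left)
qed

lemma exercise_integrable:
  assumes i: "i \<le> m" and u: "u \<in> FS (\<tau> i) \<rightarrow>\<^sub>M count_space UNIV" "\<forall>\<omega>\<in>space M. u \<omega> \<le> N"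
  shows "integrable M (\<lambda>\<omega>. real (u \<omega>) * payoff i \<omega>)"
proof -
  interpret F: sigma_finite_subalgebra M "FS (\<tau> i)" using sigma_finite_FS i by simp
  show ?thesis
    using u(2) i
    by (intro F.integrable_finite_choice[OF u(1), where f = "\<lambda>l \<omega>. real l * payoff i \<omega>" and N = N]
        integrable_mult_right payoff_integrable) simp_all
qed

text \<open>Backward induction along \<open>cash_flow_step\<close>, with \<open>k\<close> counting
  the dates to go; \<open>R\<close> is generalised because each exercise changes the state.\<close>

lemma cash_flow_integrable:
  assumes "k \<le> Suc m" "rights_at (Suc m - k) R" "q \<in> controls"
  shows "integrable M (cash_flow (Suc m - k) R q)"
  using assms
proof (induction k arbitrary: R)
  case 0
  interpret F: sigma_finite_subalgebra M "FS (\<tau> (Suc m))" using sigma_finite_FS by simp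
  show ?case
    using 0 unfolding diff_zero cash_flow_maturity[abs_def]
    by (intro F.integrable_finite_choice[where f = "\<lambda>l \<omega>. G (S (\<tau> (Suc m)) \<omega>) l" and Z = R and N = L]
        penalty_integrable) (simp_all add: rights_at_def)
next
  case (Suc k)
  let ?i = "m - k"
  \<comment> \<open>As \<open>k \<le> m\<close>, truncated subtraction is exact: the current date
    has index \<open>m - k\<close>, and the induction hypothesis lives at its successor
    \<open>Suc m - k\<close>.\<close>
  have i: "?i \<le> m" "Suc ?i = Suc m - k" "Suc m - Suc k = ?i" using Suc.prems(1) by auto
  let ?u = "\<lambda>\<omega>. q (\<tau> ?i) \<omega> * of_bool (q (\<tau> ?i) \<omega> \<le> R \<omega>)"
  have R: "rights_at ?i R" using Suc.prems i by simp
  note um = effective_exercise_measurable[OF i(1) R Suc.prems(3)]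
  have "integrable M (cash_flow (Suc m - k) (\<lambda>\<omega>. R \<omega> - ?u \<omega>) q)"
    using Suc.prems rights_at_Suc[OF i(1) R um] i by (intro Suc.IH) auto
  moreover have "integrable M (\<lambda>\<omega>. real (?u \<omega>) * payoff ?i \<omega>)"
    using R by (intro exercise_integrable[OF i(1) um, of L]) (auto simp: rights_at_def intro: order_trans)
  ultimately show ?case
    unfolding i(3) cash_flow_step[OF i(1), abs_def] i(2) by simp
qed

section \<open>Regularity of the value function\<close>

text \<open>A case split suffices in place of induction, because a conditional expectation is
  measurable for the conditioning sigma-algebra whatever its argument.\<close>

lemma value_fn_measurable: "k \<le> Suc m \<Longrightarrow> value_fn k l \<in> borel_measurable (FS (\<tau> (Suc m - k)))"
proof (cases k)
  case 0
  then show ?thesis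
    using measurable_compose[OF price_measurable penalty_measurable, of "Suc m"] by simp
next
  case (Suc n)
  then show ?thesis
    unfolding Suc value_fn.simps diff_Suc_Suc
    by (intro borel_measurable_Max borel_measurable_add borel_measurable_times borel_measurable_const
        borel_measurable_cond_exp payoff_measurable) auto
qed

lemma value_fn_integrable: "k \<le> Suc m \<Longrightarrow> l \<le> L \<Longrightarrow> integrable M (value_fn k l)"
proof (induction k arbitrary: l)
  case 0
  then show ?case using penalty_integrable by simp
next
  case (Suc k)
  interpret F: sigma_finite_subalgebra M "FS (\<tau> (m - k))" using sigma_finite_FS by simp
  show ?case unfolding value_fn.simps
    using Suc payoff_integrable[of "m - k"]
    by (intro integrable_MAX Bochner_Integration.integrable_add integrable_mult_right F.real_cond_exp_int) auto
qed

lemma bellman_le_value_fn: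
  assumes "u \<le> Lloc" "u \<le> l"
  shows "real u * payoff (m - k) \<omega>
    + discount (m - k) * real_cond_exp M (FS (\<tau> (m - k))) (value_fn k (l - u)) \<omega> \<le> value_fn (Suc k) l \<omega>"
  unfolding value_fn.simps by (rule Max_ge) (use assms in auto)

section \<open>Conditional expectations over one period\<close>

text \<open>The current payoff is known at \<open>\<tau> i\<close> and passes through the
  conditioning; the discount factor is deterministic.\<close>

lemma cond_exp_exercise:
  assumes i: "i \<le> m" and u: "u \<in> FS (\<tau> i) \<rightarrow>\<^sub>M count_space UNIV" "\<forall>\<omega>\<in>space M. u \<omega> \<le> N"
    and Y: "integrable M Y"
  shows "AE \<omega> in M. real_cond_exp M (FS (\<tau> i)) (\<lambda>\<omega>. real (u \<omega>) * payoff i \<omega> + discount i * Y \<omega>) \<omega>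
    = real (u \<omega>) * payoff i \<omega> + discount i * real_cond_exp M (FS (\<tau> i)) Y \<omega>"
proof -
  interpret F: sigma_finite_subalgebra M "FS (\<tau> i)" using sigma_finite_FS i by simp
  note int = exercise_integrable[OF i u]
  have "(\<lambda>\<omega>. real (u \<omega>) * payoff i \<omega>) \<in> borel_measurable (FS (\<tau> i))"
    using payoff_measurable[of i] i measurable_compose[OF u(1), of real borel]
    by (intro borel_measurable_times) auto
  from F.real_cond_exp_F_meas[OF int this] F.real_cond_exp_cmult[OF Y, of "discount i"]
    F.real_cond_exp_add[OF int integrable_mult_right[OF Y, of "discount i"]]
  show ?thesis by eventually_elim simp
qed

text \<open>Replaces \<open>Y\<close> by an almost surely equal function and then moves the random
  index out of the conditioning, which yields the continuation term of the Bellman maximum.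
  \<open>Y\<close> is kept abstract so as to cover rewards as well as values.\<close>

lemma cond_exp_value_fn_step:
  assumes k: "k \<le> m" and R: "rights_at (m - k) R"
    and u: "u \<in> FS (\<tau> (m - k)) \<rightarrow>\<^sub>M count_space UNIV"
    and Y: "integrable M Y" "AE \<omega> in M. Y \<omega> = value_fn k (R \<omega> - u \<omega>) \<omega>"
  shows "AE \<omega> in M. real_cond_exp M (FS (\<tau> (m - k))) Y \<omega>
    = real_cond_exp M (FS (\<tau> (m - k))) (value_fn k (R \<omega> - u \<omega>)) \<omega>"
proof -
  interpret F: sigma_finite_subalgebra M "FS (\<tau> (m - k))" using sigma_finite_FS by simp
  have Z: "(\<lambda>\<omega>. R \<omega> - u \<omega>) \<in> FS (\<tau> (m - k)) \<rightarrow>\<^sub>M count_space UNIV"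
    using R u unfolding rights_at_def by (auto intro: nat_diff_measurable)
  have bd: "R \<omega> - u \<omega> \<le> L" if "\<omega> \<in> space M" for \<omega>
    using R that by (auto simp: rights_at_def intro: le_trans[OF diff_le_self])
  have vi: "integrable M (value_fn k l)" if "l \<le> L" for l
    using value_fn_integrable k that by simp
  have "integrable M (\<lambda>\<omega>. value_fn k (R \<omega> - u \<omega>) \<omega>)"
    by (rule F.integrable_finite_choice[OF Z bd vi])
  then have "AE \<omega> in M. real_cond_exp M (FS (\<tau> (m - k))) Y \<omega>
      = real_cond_exp M (FS (\<tau> (m - k))) (\<lambda>\<omega>. value_fn k (R \<omega> - u \<omega>) \<omega>) \<omega>"
    using Y by (intro F.real_cond_exp_cong) auto
  moreover have "AE \<omega> in M. real_cond_exp M (FS (\<tau> (m - k))) (\<lambda>\<omega>. value_fn k (R \<omega> - u \<omega>) \<omega>) \<omega>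
      = real_cond_exp M (FS (\<tau> (m - k))) (value_fn k (R \<omega> - u \<omega>)) \<omega>"
    by (rule F.real_cond_exp_finite_choice[OF Z bd vi])
  ultimately show ?thesis by eventually_elim simp
qed

lemma value_fn_at_rights:
  assumes "k \<le> Suc m" "rights_at (Suc m - k) R"
  shows "integrable M (\<lambda>\<omega>. value_fn k (R \<omega>) \<omega>)"
proof -
  interpret F: sigma_finite_subalgebra M "FS (\<tau> (Suc m - k))" using sigma_finite_FS by simp
  show ?thesis using assms
    by (intro F.integrable_finite_choice[where f = "value_fn k" and Z = R and N = L] value_fn_integrable)
      (simp_all add: rights_at_def)
qed

section \<open>Every reward is dominated by the value function\<close>

lemma swing_reward_cash_flow:
  "swing_reward M FS S K \<mu> m \<tau> G i R q = real_cond_exp M (FS (\<tau> i)) (cash_flow i R q)"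
  unfolding swing_reward_def cash_flow_def[abs_def] ..

text \<open>At maturity the cash flow is the penalty alone, which is then known, so conditioning
  leaves it unchanged. Reading the reward at index \<open>Suc m\<close> gives both backward
  inductions their base case.\<close>

lemma swing_reward_maturity:
  assumes "rights_at (Suc m) R" "q \<in> controls"
  shows "AE \<omega> in M. swing_reward M FS S K \<mu> m \<tau> G (Suc m) R q \<omega> = value_fn 0 (R \<omega>) \<omega>"
proof -
  interpret F: sigma_finite_subalgebra M "FS (\<tau> (Suc m))" using sigma_finite_FS by simp
  have "(\<lambda>\<omega>. value_fn 0 (R \<omega>) \<omega>) \<in> borel_measurable (FS (\<tau> (Suc m)))"
    using assms(1) value_fn_measurable[of 0]
    by (intro measurable_compose_countable[where f = "value_fn 0" and g = R])
      (simp_all add: rights_at_def)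
  moreover have "integrable M (\<lambda>\<omega>. value_fn 0 (R \<omega>) \<omega>)"
    using value_fn_at_rights[of 0 R] assms(1) by simp
  ultimately have "AE \<omega> in M. real_cond_exp M (FS (\<tau> (Suc m))) (\<lambda>\<omega>. value_fn 0 (R \<omega>) \<omega>) \<omega>
      = value_fn 0 (R \<omega>) \<omega>"
    by (intro F.real_cond_exp_F_meas)
  then show ?thesis
    unfolding swing_reward_cash_flow cash_flow_maturity[abs_def] by simp
qed

text \<open>Tower property: conditioning the later cash flow at \<open>\<tau> (Suc i)\<close> before
  \<open>\<tau> i\<close> turns it into the later reward. Here \<open>u\<close> is the exercise that
  takes effect, an excessive request counting as zero.\<close>

lemma swing_reward_step:
  assumes i: "i \<le> m" and R: "rights_at i R" and q: "q \<in> controls"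
    and u_def: "u = (\<lambda>\<omega>. q (\<tau> i) \<omega> * of_bool (q (\<tau> i) \<omega> \<le> R \<omega>))"
  shows "AE \<omega> in M. swing_reward M FS S K \<mu> m \<tau> G i R q \<omega> = real (u \<omega>) * payoff i \<omega>
    + discount i * real_cond_exp M (FS (\<tau> i))
        (swing_reward M FS S K \<mu> m \<tau> G (Suc i) (\<lambda>\<omega>. R \<omega> - u \<omega>) q) \<omega>"
proof -
  interpret F: sigma_finite_subalgebra M "FS (\<tau> i)" using sigma_finite_FS i by simp
  let ?c = "cash_flow (Suc i) (\<lambda>\<omega>. R \<omega> - u \<omega>) q"
  have um: "u \<in> FS (\<tau> i) \<rightarrow>\<^sub>M count_space UNIV"
    unfolding u_def by (rule effective_exercise_measurable[OF i R q])
  have ub: "\<forall>\<omega>\<in>space M. u \<omega> \<le> L"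
    using R by (auto simp: u_def rights_at_def intro: order_trans)
  have c: "integrable M ?c"
    using cash_flow_integrable[of "m - i"] rights_at_Suc[OF i R um] q i
    by (simp add: Suc_diff_le)
  have "AE \<omega> in M. real_cond_exp M (FS (\<tau> i)) (real_cond_exp M (FS (\<tau> (Suc i))) ?c) \<omega>
      = real_cond_exp M (FS (\<tau> i)) ?c \<omega>"
    using i by (intro F.real_cond_exp_nested_subalg subalg subalg_Suc c) auto
  with cond_exp_exercise[OF i um ub c] show ?thesis
    unfolding swing_reward_cash_flow cash_flow_step[OF i, abs_def] u_def
    by eventually_elim simp
qed

lemma swing_reward_integrable:
  assumes "k \<le> Suc m" "rights_at (Suc m - k) R" "q \<in> controls"
  shows "integrable M (swing_reward M FS S K \<mu> m \<tau> G (Suc m - k) R q)"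
proof -
  interpret F: sigma_finite_subalgebra M "FS (\<tau> (Suc m - k))" using sigma_finite_FS by simp
  show ?thesis unfolding swing_reward_cash_flow
    by (intro F.real_cond_exp_int cash_flow_integrable assms)
qed

text \<open>Backward induction: monotonicity of conditional expectation carries the bound over from
  the next date, and the effective exercise respects both limits, so it is one of the candidates in
  the Bellman maximum.\<close>

lemma swing_reward_le_value_fn:
  assumes "k \<le> Suc m" "rights_at (Suc m - k) R" "q \<in> controls"
  shows "AE \<omega> in M. swing_reward M FS S K \<mu> m \<tau> G (Suc m - k) R q \<omega> \<le> value_fn k (R \<omega>) \<omega>"
  using assms
proof (induction k arbitrary: R)
  case 0
  then have "AE \<omega> in M. swing_reward M FS S K \<mu> m \<tau> G (Suc m) R q \<omega> = value_fn 0 (R \<omega>) \<omega>"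
    by (intro swing_reward_maturity) auto
  then show ?case by eventually_elim simp
next
  case (Suc k)
  define i where "i = m - k"
  have k: "k \<le> m" and i: "i \<le> m" "Suc i = Suc m - k" "Suc m - Suc k = i"
    using Suc.prems(1) by (auto simp: i_def)
  interpret F: sigma_finite_subalgebra M "FS (\<tau> i)" using sigma_finite_FS i by simp
  define u where "u = (\<lambda>\<omega>. q (\<tau> i) \<omega> * of_bool (q (\<tau> i) \<omega> \<le> R \<omega>))"
  have R: "rights_at i R" using Suc.prems i by simp
  have um: "u \<in> FS (\<tau> i) \<rightarrow>\<^sub>M count_space UNIV"
    unfolding u_def by (rule effective_exercise_measurable[OF i(1) R Suc.prems(3)])
  have u_le: "u \<omega> \<le> Lloc" "u \<omega> \<le> R \<omega>" if "\<omega> \<in> space M" for \<omega>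
    using Suc.prems(3) i(1) that by (auto simp: u_def admissible_controls_def)
  let ?R' = "\<lambda>\<omega>. R \<omega> - u \<omega>"
  have R': "rights_at (Suc m - k) ?R'" using rights_at_Suc[OF i(1) R um] i(2) by simp
  have k': "k \<le> Suc m" using k by simp
  note v = value_fn_at_rights[OF k' R']
  have "AE \<omega> in M. real_cond_exp M (FS (\<tau> i)) (swing_reward M FS S K \<mu> m \<tau> G (Suc m - k) ?R' q) \<omega>
      \<le> real_cond_exp M (FS (\<tau> i)) (\<lambda>\<omega>. value_fn k (?R' \<omega>) \<omega>) \<omega>"
    by (intro F.real_cond_exp_mono Suc.IH k' R' Suc.prems(3) v swing_reward_integrable)
  moreover have "AE \<omega> in M. real_cond_exp M (FS (\<tau> i)) (\<lambda>\<omega>. value_fn k (?R' \<omega>) \<omega>) \<omega>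
      = real_cond_exp M (FS (\<tau> i)) (value_fn k (?R' \<omega>)) \<omega>"
    using cond_exp_value_fn_step[OF k _ _ v] R um by (simp add: i_def)
  ultimately show ?case
    using swing_reward_step[OF i(1) R Suc.prems(3) u_def] AE_space unfolding i(2,3)
  proof eventually_elim
    case (elim \<omega>)
    have "swing_reward M FS S K \<mu> m \<tau> G i R q \<omega>
        \<le> real (u \<omega>) * payoff i \<omega> + discount i * real_cond_exp M (FS (\<tau> i)) (value_fn k (?R' \<omega>)) \<omega>"
      using elim by (simp add: i(2))
    also have "\<dots> \<le> value_fn (Suc k) (R \<omega>) \<omega>"
      using bellman_le_value_fn[OF u_le[OF elim(4)], of k] by (simp add: i_def)
    finally show ?case .
  qed
qed

section \<open>An optimal control by measurable selection\<close>

text \<open>A finite maximum is attained, and its least maximiser is measurable for each fixed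
  \<open>l\<close>; inserting the integer-valued \<open>R\<close> preserves this. As
  \<open>value_fn\<close> is built from fixed versions of the conditional expectations, the identity
  holds at every outcome.\<close>

lemma optimal_exercise:
  assumes k: "k \<le> m" and R: "rights_at (m - k) R"
  obtains u where "u \<in> FS (\<tau> (m - k)) \<rightarrow>\<^sub>M count_space UNIV" "\<And>\<omega>. u \<omega> \<le> Lloc" "\<And>\<omega>. u \<omega> \<le> R \<omega>"
    "\<And>\<omega>. real (u \<omega>) * payoff (m - k) \<omega>
      + discount (m - k) * real_cond_exp M (FS (\<tau> (m - k))) (value_fn k (R \<omega> - u \<omega>)) \<omega>
      = value_fn (Suc k) (R \<omega>) \<omega>"
proof -
  define B where "B l u \<omega> = real u * payoff (m - k) \<omega>
    + discount (m - k) * real_cond_exp M (FS (\<tau> (m - k))) (value_fn k (l - u)) \<omega>" for l u \<omega>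
  \<comment> \<open>Optimality is phrased as equality with the maximum, so that for fixed
    \<open>l\<close> and \<open>u\<close> it is an event comparing two measurable functions.\<close>
  define opt where "opt l \<omega> u \<longleftrightarrow> u \<le> min Lloc l \<and> B l u \<omega> = value_fn (Suc k) l \<omega>" for l \<omega> u
  define u where "u \<omega> = (LEAST u. opt (R \<omega>) \<omega> u)" for \<omega>
  have "\<exists>u. opt l \<omega> u" for l \<omega>
  proof -
    have "value_fn (Suc k) l \<omega> \<in> (\<lambda>u. B l u \<omega>) ` {0..min Lloc l}"
      unfolding value_fn.simps B_def by (rule Max_in) auto
    then show ?thesis by (auto simp: opt_def)
  qed
  then have opt: "opt (R \<omega>) \<omega> (u \<omega>)" for \<omega>
    unfolding u_def by (rule LeastI_ex)
  have "(\<lambda>\<omega>. LEAST u. opt l \<omega> u) \<in> FS (\<tau> (m - k)) \<rightarrow>\<^sub>M count_space UNIV" for l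
  proof (rule measurable_Least)
    fix n
    have [measurable]: "value_fn (Suc k) l \<in> borel_measurable (FS (\<tau> (m - k)))"
      using value_fn_measurable[of "Suc k" l] k by (simp del: value_fn.simps)
    have [measurable]: "B l n \<in> borel_measurable (FS (\<tau> (m - k)))"
      unfolding B_def
      by (intro borel_measurable_add borel_measurable_times borel_measurable_const
          borel_measurable_cond_exp payoff_measurable) simp
    show "Measurable.pred (FS (\<tau> (m - k))) (\<lambda>\<omega>. opt l \<omega> n)"
      unfolding opt_def by measurable
  qed
  then have "u \<in> FS (\<tau> (m - k)) \<rightarrow>\<^sub>M count_space UNIV"
    unfolding u_def using R
    by (intro measurable_compose_countable[where f = "\<lambda>l \<omega>. LEAST u. opt l \<omega> u" and g = R])
      (simp_all add: rights_at_def)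
  then show ?thesis using opt by (intro that[of u]) (auto simp: opt_def B_def)
qed

text \<open>The reward looks only at decisions from \<open>\<tau> i\<close> on, which permits
  overriding a control at an earlier date.\<close>

lemma swing_reward_cong:
  assumes "\<And>j. i \<le> j \<Longrightarrow> j \<le> m \<Longrightarrow> q (\<tau> j) = q' (\<tau> j)"
  shows "swing_reward M FS S K \<mu> m \<tau> G i R q = swing_reward M FS S K \<mu> m \<tau> G i R q'"
proof -
  have "remaining_rights \<tau> q i R (j - i) \<omega> = remaining_rights \<tau> q' i R (j - i) \<omega>"
    if "j \<le> Suc m" for j \<omega>
    using that assms by (intro remaining_rights_cong) auto
  then have "cash_flow i R q = cash_flow i R q'"
    using assms unfolding cash_flow_def[abs_def] by (auto intro!: ext sum.cong)
  then show ?thesis unfolding swing_reward_cash_flow by simp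
qed

lemma swing_reward_attains_value_fn:
  assumes "k \<le> Suc m" "rights_at (Suc m - k) R"
  shows "\<exists>q\<in>controls. AE \<omega> in M. swing_reward M FS S K \<mu> m \<tau> G (Suc m - k) R q \<omega> = value_fn k (R \<omega>) \<omega>"
  using assms
proof (induction k arbitrary: R)
  case 0
  \<comment> \<open>No decision remains at maturity, so any admissible control serves.\<close>
  have "(\<lambda>_ _. 0) \<in> controls" by (auto simp: admissible_controls_def)
  with swing_reward_maturity[OF _ this, of R] 0 show ?case
    unfolding diff_zero by (intro bexI[of _ "\<lambda>_ _. 0"])
next
  case (Suc k)
  define i where "i = m - k"
  have k: "k \<le> m" "k \<le> Suc m" and i: "i \<le> m" "Suc i = Suc m - k" "Suc m - Suc k = i"
    using Suc.prems(1) by (auto simp: i_def)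
  have R: "rights_at i R" using Suc.prems i by simp
  obtain u where um: "u \<in> FS (\<tau> i) \<rightarrow>\<^sub>M count_space UNIV" and u_le: "\<And>\<omega>. u \<omega> \<le> Lloc" "\<And>\<omega>. u \<omega> \<le> R \<omega>"
    and u_opt: "\<And>\<omega>. real (u \<omega>) * payoff i \<omega>
      + discount i * real_cond_exp M (FS (\<tau> i)) (value_fn k (R \<omega> - u \<omega>)) \<omega> = value_fn (Suc k) (R \<omega>) \<omega>"
    using optimal_exercise[OF k(1)] R unfolding i_def by metis
  let ?R' = "\<lambda>\<omega>. R \<omega> - u \<omega>"
  have R': "rights_at (Suc m - k) ?R'" using rights_at_Suc[OF i(1) R um] i(2) by simp
  obtain q' where q': "q' \<in> controls"
    "AE \<omega> in M. swing_reward M FS S K \<mu> m \<tau> G (Suc m - k) ?R' q' \<omega> = value_fn k (?R' \<omega>) \<omega>"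
    using Suc.IH[OF k(2) R'] by auto
  \<comment> \<open>The control that is optimal from the next date on, started from the rights left
    by \<open>u\<close>, is spliced with \<open>u\<close> at the current date.\<close>
  define q where "q = q'(\<tau> i := u)"
  have q: "q \<in> controls" using q'(1) um u_le by (auto simp: admissible_controls_def q_def)
  \<comment> \<open>Since \<open>u\<close> never exceeds \<open>R\<close>, the whole request takes
    effect.\<close>
  have u_eq: "u = (\<lambda>\<omega>. q (\<tau> i) \<omega> * of_bool (q (\<tau> i) \<omega> \<le> R \<omega>))"
    using u_le by (auto simp: q_def)
  \<comment> \<open>The dates are distinct, so the override is invisible from the next date
    on.\<close>
  have "q (\<tau> j) = q' (\<tau> j)" if "Suc m - k \<le> j" "j \<le> m" for j
  proof -
    have "\<tau> j \<noteq> \<tau> i"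
      using inj_on_eq_iff[OF \<tau>_inj, of j i] that i(1,2) by auto
    then show ?thesis by (simp add: q_def)
  qed
  then have later: "swing_reward M FS S K \<mu> m \<tau> G (Suc m - k) ?R' q
      = swing_reward M FS S K \<mu> m \<tau> G (Suc m - k) ?R' q'"
    by (rule swing_reward_cong)
  have "AE \<omega> in M. real_cond_exp M (FS (\<tau> i)) (swing_reward M FS S K \<mu> m \<tau> G (Suc m - k) ?R' q) \<omega>
      = real_cond_exp M (FS (\<tau> i)) (value_fn k (?R' \<omega>)) \<omega>"
    unfolding later i_def
    using swing_reward_integrable[OF k(2) R' q'(1)] q'(2)
    by (intro cond_exp_value_fn_step[OF k(1) R[unfolded i_def] um[unfolded i_def]])
  with swing_reward_step[OF i(1) R q u_eq]
  have "AE \<omega> in M. swing_reward M FS S K \<mu> m \<tau> G i R q \<omega> = value_fn (Suc k) (R \<omega>) \<omega>"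
    unfolding i(2)
  proof eventually_elim
    case (elim \<omega>)
    then show ?case using u_opt[of \<omega>] unfolding i(2) by (simp only:)
  qed
  then show ?case using q unfolding i(3) by blast
qed

section \<open>Identification of the value functional and dynamic programming\<close>

text \<open>The domination and attainment results are exactly what
  \<open>family_esssup_attained\<close> asks for. The case \<open>k = 0\<close> is separate because
  there \<open>swing_value\<close> is the penalty by definition and not a supremum.\<close>

lemma swing_value_eq_value_fn:
  assumes "k \<le> Suc m" "rights_at (Suc m - k) R"
  shows "swing_value M FS S K \<mu> m \<tau> Lloc G (Suc m - k) R \<in> borel_measurable M"
    "AE \<omega> in M. swing_value M FS S K \<mu> m \<tau> Lloc G (Suc m - k) R \<omega> = value_fn k (R \<omega>) \<omega>"
proof -
  let ?A = "swing_reward M FS S K \<mu> m \<tau> G (Suc m - k) R ` controls"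
  let ?V = "swing_value M FS S K \<mu> m \<tau> Lloc G (Suc m - k) R"
  have v: "(\<lambda>\<omega>. value_fn k (R \<omega>) \<omega>) \<in> borel_measurable M"
    using value_fn_at_rights[OF assms] by auto
  have "?V \<in> borel_measurable M \<and> (AE \<omega> in M. ?V \<omega> = value_fn k (R \<omega>) \<omega>)"
  proof (cases k)
    case 0
    then show ?thesis using v by (simp add: swing_value_def)
  next
    case (Suc n)
    obtain q where q: "q \<in> controls"
      "AE \<omega> in M. swing_reward M FS S K \<mu> m \<tau> G (Suc m - k) R q \<omega> = value_fn k (R \<omega>) \<omega>"
      using swing_reward_attains_value_fn[OF assms] by auto
    have ub: "AE \<omega> in M. h \<omega> \<le> value_fn k (R \<omega>) \<omega>" if "h \<in> ?A" for h
      using that swing_reward_le_value_fn[OF assms] by fast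
    have "swing_reward M FS S K \<mu> m \<tau> G (Suc m - k) R q \<in> ?A" using q(1) by (rule imageI)
    from family_esssup_attained[OF v ub this q(2)] Suc show ?thesis
      by (simp add: swing_value_def del: value_fn.simps)
  qed
  then show "?V \<in> borel_measurable M" "AE \<omega> in M. ?V \<omega> = value_fn k (R \<omega>) \<omega>" by auto
qed

text \<open>Exchanges \<open>swing_value\<close>, which is determined only up to null sets, for
  \<open>value_fn\<close> under the conditioning; integrability passes along the almost sure
  equality.\<close>

lemma cond_exp_exercise_swing_value:
  assumes k: "k \<le> m" and R: "rights_at (m - k) R"
    and u: "u \<in> FS (\<tau> (m - k)) \<rightarrow>\<^sub>M count_space UNIV" "\<forall>\<omega>\<in>space M. u \<omega> \<le> N"
  shows "AE \<omega> in M. real_cond_exp M (FS (\<tau> (m - k)))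
      (\<lambda>\<omega>. real (u \<omega>) * payoff (m - k) \<omega> + discount (m - k)
         * swing_value M FS S K \<mu> m \<tau> Lloc G (Suc (m - k)) (\<lambda>\<omega>. R \<omega> - u \<omega>) \<omega>) \<omega>
    = real (u \<omega>) * payoff (m - k) \<omega>
      + discount (m - k) * real_cond_exp M (FS (\<tau> (m - k))) (value_fn k (R \<omega> - u \<omega>)) \<omega>"
proof -
  let ?R' = "\<lambda>\<omega>. R \<omega> - u \<omega>"
  let ?V = "swing_value M FS S K \<mu> m \<tau> Lloc G (Suc (m - k)) ?R'"
  have i: "m - k \<le> m" "Suc m - k = Suc (m - k)" "k \<le> Suc m" using k by auto
  have R': "rights_at (Suc m - k) ?R'" using rights_at_Suc[OF i(1) R u(1)] i(2) by simp
  note V = swing_value_eq_value_fn[OF i(3) R', unfolded i(2)]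
  have V_int: "integrable M ?V"
    using value_fn_at_rights[OF i(3) R'] V
    by (subst integrable_cong_AE[OF V(1) _ V(2)]) auto
  from cond_exp_exercise[OF i(1) u V_int] cond_exp_value_fn_step[OF k R u(1) V_int V(2)]
  show ?thesis by eventually_elim simp
qed

text \<open>Both sides equal \<open>value_fn\<close> at \<open>R\<close>. On the right each member
  of the family is almost surely a candidate in the Bellman maximum, and the exercise from
  \<open>optimal_exercise\<close> attains it.\<close>

lemma dynamic_programming_principle:
  assumes i: "i \<le> m" and R: "rights_at i R"
  shows "AE \<omega> in M. swing_value M FS S K \<mu> m \<tau> Lloc G i R \<omega> =
    family_esssup M
      {real_cond_exp M (FS (\<tau> i))
         (\<lambda>\<omega>. real (u \<omega>) * payoff i \<omega>
            + discount i * swing_value M FS S K \<mu> m \<tau> Lloc G (Suc i) (\<lambda>\<omega>. R \<omega> - u \<omega>) \<omega>)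
       | u. u \<in> FS (\<tau> i) \<rightarrow>\<^sub>M count_space UNIV \<and> (\<forall>\<omega>\<in>space M. u \<omega> \<in> {0..Lloc} \<and> u \<omega> \<le> R \<omega>)} \<omega>"
    (is "AE \<omega> in M. _ = family_esssup M ?A \<omega>")
proof -
  \<comment> \<open>The number of dates to go after the exercise at \<open>\<tau> i\<close>, so that
    \<open>value_fn (Suc k)\<close> belongs to \<open>\<tau> i\<close> and \<open>value_fn k\<close>
    to the next date.\<close>
  define k where "k = m - i"
  have k: "k \<le> m" "m - k = i" "Suc k \<le> Suc m" "Suc m - Suc k = i" using i by (auto simp: k_def)
  note step = cond_exp_exercise_swing_value[OF k(1), unfolded k(2), OF R]
  obtain u where u: "u \<in> FS (\<tau> i) \<rightarrow>\<^sub>M count_space UNIV" "\<And>\<omega>. u \<omega> \<le> Lloc" "\<And>\<omega>. u \<omega> \<le> R \<omega>"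
    "\<And>\<omega>. real (u \<omega>) * payoff i \<omega>
      + discount i * real_cond_exp M (FS (\<tau> i)) (value_fn k (R \<omega> - u \<omega>)) \<omega> = value_fn (Suc k) (R \<omega>) \<omega>"
    using optimal_exercise[OF k(1), unfolded k(2), OF R] by metis
  let ?h = "real_cond_exp M (FS (\<tau> i)) (\<lambda>\<omega>. real (u \<omega>) * payoff i \<omega>
          + discount i * swing_value M FS S K \<mu> m \<tau> Lloc G (Suc i) (\<lambda>\<omega>. R \<omega> - u \<omega>) \<omega>)"
  have "AE \<omega> in M. family_esssup M ?A \<omega> = value_fn (Suc k) (R \<omega>) \<omega>"
  proof (rule family_esssup_attained(2)[where ?h0.0 = ?h])
    show "(\<lambda>\<omega>. value_fn (Suc k) (R \<omega>) \<omega>) \<in> borel_measurable M"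
      using value_fn_at_rights[OF k(3), unfolded k(4), OF R] by (rule borel_measurable_integrable)
  next
    fix h assume "h \<in> ?A"
    then obtain u where h: "h = real_cond_exp M (FS (\<tau> i)) (\<lambda>\<omega>. real (u \<omega>) * payoff i \<omega>
            + discount i * swing_value M FS S K \<mu> m \<tau> Lloc G (Suc i) (\<lambda>\<omega>. R \<omega> - u \<omega>) \<omega>)"
      and u: "u \<in> FS (\<tau> i) \<rightarrow>\<^sub>M count_space UNIV" "\<forall>\<omega>\<in>space M. u \<omega> \<le> Lloc" "\<forall>\<omega>\<in>space M. u \<omega> \<le> R \<omega>"
      by auto
    from step[OF u(1,2)] AE_space show "AE \<omega> in M. h \<omega> \<le> value_fn (Suc k) (R \<omega>) \<omega>"
    proof eventually_elim
      case (elim \<omega>)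
      then show ?case
        using bellman_le_value_fn[of "u \<omega>" "R \<omega>" k \<omega>] u(2,3) by (simp add: h k(2))
    qed
  next
    show "?h \<in> ?A" using u(1-3) by auto
    show "AE \<omega> in M. ?h \<omega> = value_fn (Suc k) (R \<omega>) \<omega>"
      using step[OF u(1), of Lloc] u(2) unfolding u(4) by blast
  qed
  with swing_value_eq_value_fn(2)[OF k(3), unfolded k(4), OF R] show ?thesis
    by eventually_elim simp
qed

end

section \<open>Generated and augmented filtrations\<close>

lemma generated_filtration_measurable:
  assumes "s \<in> {0..t}"
  shows "X s \<in> borel_measurable (generated_filtration M X t)"
proof (rule measurableI)
  fix A :: "real set" assume A: "A \<in> sets borel"
  show "X s -` A \<inter> space (generated_filtration M X t) \<in> sets (generated_filtration M X t)"
    unfolding generated_filtration_def space_measure_of_conv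
    by (rule in_measure_of) (use assms A in blast)+
qed simp

lemma subalgebra_sigma:
  assumes "space N = \<Omega>" "A \<subseteq> sets N"
  shows "subalgebra N (sigma \<Omega> A)"
proof -
  \<comment> \<open>This inclusion guarantees that the measurable sets of
    \<open>sigma \<Omega> A\<close> are the ones generated by \<open>A\<close>.\<close>
  have "A \<subseteq> Pow \<Omega>" using assms sets.space_closed[of N] by auto
  then show ?thesis
    using assms sets.sigma_sets_subset[of A N]
    by (simp add: subalgebra_def space_measure_of_conv)
qed

text \<open>Taking \<open>N\<close> to be \<open>M\<close> embeds the filtration in the probability
  space; taking a later member of the filtration gives monotonicity in time.\<close>

lemma generated_filtration_subalgebra:
  assumes "space N = space M" "\<And>s. s \<in> {0..t} \<Longrightarrow> X s \<in> borel_measurable N"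
  shows "subalgebra N (generated_filtration M X t)"
  unfolding generated_filtration_def
proof (intro subalgebra_sigma assms(1) subsetI)
  fix B assume "B \<in> {X s -` A \<inter> space M | s A. s \<in> {0..t} \<and> A \<in> sets borel}"
  then obtain s A where "B = X s -` A \<inter> space N" "s \<in> {0..t}" "A \<in> sets borel"
    using assms(1) by auto
  then show "B \<in> sets N" using measurable_sets[OF assms(2)] by simp
qed

lemma augmented_filtration_subalgebra:
  assumes "\<And>s. s \<in> {0..t} \<Longrightarrow> X s \<in> borel_measurable M"
  shows "subalgebra M (augmented_filtration M X t)"
  unfolding augmented_filtration_def
proof (intro subalgebra_sigma refl Un_least subsetI)
  fix B assume "B \<in> {X s -` A \<inter> space M | s A. s \<in> {0..t} \<and> A \<in> sets borel}"
  then obtain s A where "B = X s -` A \<inter> space M" "s \<in> {0..t}" "A \<in> sets borel" by auto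
  then show "B \<in> sets M" using measurable_sets[OF assms] by simp
qed auto

section \<open>The price model as an instance of the contract\<close>

theorem theorem5p1:
  fixes M :: "'a measure"
    and W Y X S :: "real \<Rightarrow> 'a \<Rightarrow> real"
    and FS :: "real \<Rightarrow> 'a measure"
    and \<alpha> \<delta> lam V0 V1 V2 r \<gamma>1 \<gamma>2 y0 x0 T K \<mu> :: real
    and P :: "real \<Rightarrow> real"
    and L Lloc m :: nat
    and \<tau> :: "nat \<Rightarrow> real"
    and G :: "real \<Rightarrow> nat \<Rightarrow> real"
  assumes "prob_space M" and "complete_measure M"
    and "wiener_process M W"
    and "1/2 < \<alpha>" "\<alpha> < 3/2" "\<delta> > 0"
    and "lam \<ge> 0" "V0 \<ge> 0" "V1 \<ge> 0" "V2 \<ge> 0"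
    and "\<exists>p>0. \<forall>t\<ge>0. P (t + p) = P t"
    and "price_storage_solution M (augmented_filtration M W) W T
           \<alpha> \<delta> lam r V0 V1 V2 \<gamma>1 \<gamma>2 P y0 x0 Y X"
    and "S = (\<lambda>t \<omega>. exp (Y t \<omega>))"
    and "FS = generated_filtration M S"
    and "K > 0" "\<mu> \<ge> 0"
    and "m \<ge> 1" "strict_mono_on {0..Suc m} \<tau>" "\<tau> 0 \<ge> 0" "\<tau> (Suc m) = T"
    and "Lloc \<le> L" "L \<le> (m + 1) * Lloc"
    and "(\<lambda>(s, l). G s l) \<in> borel_measurable (borel \<Otimes>\<^sub>M count_space UNIV)"
    and "\<forall>l\<in>{0..L}. integrable M (\<lambda>\<omega>. G (S T \<omega>) l)"
  shows "\<forall>i\<in>{0..m}. \<forall>Q.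
    Q \<in> FS (\<tau> i) \<rightarrow>\<^sub>M count_space UNIV \<and> (\<forall>\<omega>\<in>space M. Q \<omega> \<in> {0..L}) \<longrightarrow>
    (AE \<omega> in M.
       swing_value M FS S K \<mu> m \<tau> Lloc G i Q \<omega> =
       family_esssup M
         {real_cond_exp M (FS (\<tau> i))
            (\<lambda>\<omega>. real (q \<omega>) * max 0 (K - S (\<tau> i) \<omega>)
                  + exp (- \<mu> * (\<tau> (Suc i) - \<tau> i))
                    * swing_value M FS S K \<mu> m \<tau> Lloc G (Suc i) (\<lambda>\<omega>. Q \<omega> - q \<omega>) \<omega>)
          | q. q \<in> FS (\<tau> i) \<rightarrow>\<^sub>M count_space UNIV \<and>
               (\<forall>\<omega>\<in>space M. q \<omega> \<in> {0..Lloc} \<and> q \<omega> \<le> Q \<omega>)} \<omega>)"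
proof -
  note sol = assms(12) and S = assms(13) and FS = assms(14)
  have \<tau>_mono: "\<tau> i \<le> \<tau> j" if "i \<le> j" "j \<le> Suc m" for i j
    using strict_mono_on_leD[OF assms(18)] that by simp
  have \<tau>_range: "0 \<le> \<tau> j" "\<tau> j \<le> T" if "j \<le> Suc m" for j
    using \<tau>_mono[of 0 j] \<tau>_mono[of j "Suc m"] assms(19,20) that by auto
  \<comment> \<open>The log-price is adapted to the augmented Wiener filtration, which lies inside
    \<open>M\<close>; its exponential is therefore a random variable on \<open>M\<close>.\<close>
  have S_meas: "S s \<in> borel_measurable M" if "s \<in> {0..T}" for s
  proof -
    have "subalgebra M (augmented_filtration M W s)"
      using assms(3) by (intro augmented_filtration_subalgebra) (auto simp: wiener_process_def)
    moreover have "Y s \<in> borel_measurable (augmented_filtration M W s)"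
      using sol that by (auto simp: price_storage_solution_def)
    ultimately have "Y s \<in> borel_measurable M" by (rule measurable_from_subalg)
    then show ?thesis unfolding S by measurable
  qed
  have sub: "subalgebra M (FS (\<tau> j))" if "j \<le> Suc m" for j
    unfolding FS using \<tau>_range[OF that] by (intro generated_filtration_subalgebra S_meas) auto
  interpret swing_contract M FS S K \<mu> m \<tau> L Lloc G
  proof (intro swing_contract.intro swing_contract_axioms.intro assms(1) sub)
    show "subalgebra (FS (\<tau> (Suc j))) (FS (\<tau> j))" if "j \<le> m" for j
      using sub[of "Suc j"] \<tau>_mono[of j "Suc j"] that unfolding FS
      by (intro generated_filtration_subalgebra generated_filtration_measurable)
        (auto simp: subalgebra_def)
    show "S (\<tau> j) \<in> borel_measurable (FS (\<tau> j))" if "j \<le> Suc m" for j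
      unfolding FS using \<tau>_range[OF that] by (intro generated_filtration_measurable) auto
    show "0 \<le> S t \<omega>" for t \<omega> by (simp add: S)
    show "inj_on \<tau> {0..Suc m}" using assms(18) by (rule strict_mono_on_imp_inj_on)
    show "(\<lambda>x. G x l) \<in> borel_measurable borel" for l
    proof -
      \<comment> \<open>Sections of a jointly measurable function are measurable.\<close>
      have "(\<lambda>x. (\<lambda>(s, l). G s l) (x, l)) \<in> borel_measurable borel"
        by (rule measurable_compose[OF _ assms(23)]) simp
      then show ?thesis by simp
    qed
    show "integrable M (\<lambda>\<omega>. G (S (\<tau> (Suc m)) \<omega>) l)" if "l \<le> L" for l
      using assms(20,24) that by simp
  qed
  show ?thesis
    using dynamic_programming_principle by (auto simp: rights_at_def)
qed

end
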